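(* Let $\lambda_1,\lambda_2\in\mathbb{R}$, let $A=\begin{pmatrix}\lambda_1&0\\ 0&\lambda_2\end{pmatrix}$, and let $T:\mathbb{R}^2\to\mathbb{R}^2$, $Tx=Ax$. (i) If $\lambda_1\neq\lambda_2$, then for every $x^*=\begin{pmatrix}x_1^*\\ x_2^*\end{pmatrix}$ with $x_1^*x_2^*\neq 0$, $T$ is weakly transitive for $x^*$ in weak topology. (ii) If $\lambda_1=\lambda_2$, then for every nonzero $x^*\in\mathbb{R}^2$, $T$ is not weakly transitive for $x^*$ in weak topology. (iii) For all $\lambda_1,\lambda_2$, $T$ is not strongly transitive in weak topology.
   Context: Let $\mathbb{N}=\{1,2,3,\dots\}$. Continuous linear functionals on $\mathbb{R}^2$ are identified with vectors $x^*\in\mathbb{R}^2$ via $\langle x,x^*\rangle=x_1x_1^*+x_2x_2^*$, and $p_{x^*}(x)=|\langle x,x^*\rangle|$. For a nonzero $x^*$, a map $T:\mathbb{R}^2\to\mathbb{R}^2$ is weakly transitive for $x^*$ in weak topology if for all $x,y\in\mathbb{R}^2$ and $\varepsilon>0$ there exist $n\in\mathbb{N}$ and $z\in\mathbb{R}^2$ with $p_{x^*}(z-x)<\varepsilon$ and $p_{x^*}(T^nz-y)<\varepsilon$. $T$ is weakly transitive in weak topology if this holds for some nonzero $x^*$, and strongly transitive in weak topology if it holds for every nonzero $x^*$. *)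

theory Defs
  imports "HOL-Analysis.Analysis"
begin

text \<open>The pairing of \<open>x\<close> with the functional represented by \<open>xs\<close> is the standard inner
  product of \<open>real^2\<close>, that is \<open>x $ 1 * xs $ 1 + x $ 2 * xs $ 2\<close>.\<close>

definition functional_seminorm :: "real^2 \<Rightarrow> real^2 \<Rightarrow> real" where
  "functional_seminorm xs x = \<bar>x \<bullet> xs\<bar>"

text \<open>The iterate exponent ranges over the positive integers, so \<open>n = 0\<close> is excluded.
  The notion is meant for nonzero \<open>xs\<close>; this is a condition on \<open>xs\<close> wherever it is used, not
  part of the predicate.\<close>

definition weakly_transitive_for :: "(real^2 \<Rightarrow> real^2) \<Rightarrow> real^2 \<Rightarrow> bool" where
  "weakly_transitive_for T xs \<longleftrightarrow>
     (\<forall>x y. \<forall>\<epsilon>>0. \<exists>n\<ge>1. \<exists>z.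
        functional_seminorm xs (z - x) < \<epsilon> \<and> functional_seminorm xs ((T ^^ n) z - y) < \<epsilon>)"

definition strongly_transitive :: "(real^2 \<Rightarrow> real^2) \<Rightarrow> bool" where
  "strongly_transitive T \<longleftrightarrow> (\<forall>xs. xs \<noteq> 0 \<longrightarrow> weakly_transitive_for T xs)"

end

theory Submission
  imports Defs
begin

text \<open>Everything is seen through the single number \<open>x \<bullet> xs\<close>, and the question is whether
  applying \<open>T\<close> leaves this number free to move.

  If \<open>xs\<close> is an eigenvector of the adjoint of \<open>T\<close>, say with eigenvalue \<open>l\<close>, then \<open>T\<close> acts on
  this number as multiplication by \<open>l\<close>, and a scaling of the real line is never transitive: it
  either never expands or always expands, so that it cannot leave a neighbourhood of \<open>0\<close> or
  cannot enter one (\<open>not_weakly_transitive_for_eigenfunctional\<close>). For \<open>l1 = l2\<close> every \<open>xs\<close> is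
  such an eigenvector, and for arbitrary \<open>l1\<close>, \<open>l2\<close> the first basis vector is one, which
  already rules out strong transitivity.

  If \<open>l1 \<noteq> l2\<close> and both components of \<open>xs\<close> are nonzero, then \<open>xs\<close> and its image under the
  (symmetric) matrix are linearly independent, so \<open>z \<bullet> xs\<close> and \<open>T z \<bullet> xs\<close> can be prescribed
  independently: a single step reaches the target exactly
  (\<open>weakly_transitive_for_diagonal\<close>).\<close>

lemma diagonal_inner:
  fixes l1 l2 :: real and x xs :: "real^2"
  shows "((vector [vector [l1, 0], vector [0, l2]] :: real^2^2) *v x) \<bullet> xs
    = l1 * x $ 1 * xs $ 1 + l2 * x $ 2 * xs $ 2"
  by (simp add: inner_vec_def sum_2 matrix_vector_mult_def)

lemma eigenfunctional_funpow:
  fixes T :: "real^2 \<Rightarrow> real^2" and l :: real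
  assumes "\<And>x. T x \<bullet> xs = l * (x \<bullet> xs)"
  shows "(T ^^ n) x \<bullet> xs = l ^ n * (x \<bullet> xs)"
  by (induction n) (simp_all add: assms)

text \<open>The value \<open>t = x \<bullet> xs\<close> evolves by \<open>t \<mapsto> l * t\<close>. For \<open>\<bar>l\<bar> \<le> 1\<close> no orbit starting in
  \<open>\<bar>t\<bar> < 1\<close> comes within \<open>1\<close> of \<open>3\<close>, and for \<open>\<bar>l\<bar> > 1\<close> no orbit starting within \<open>1\<close> of \<open>3\<close>
  enters \<open>\<bar>t\<bar> < 1\<close>.\<close>

lemma not_weakly_transitive_for_eigenfunctional:
  fixes T :: "real^2 \<Rightarrow> real^2" and l :: real
  assumes eigen: "\<And>x. T x \<bullet> xs = l * (x \<bullet> xs)" and nz: "xs \<noteq> 0"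
  shows "\<not> weakly_transitive_for T xs"
proof
  assume wt: "weakly_transitive_for T xs"
  define w where "w = (3 / (xs \<bullet> xs)) *\<^sub>R xs"
  have w: "w \<bullet> xs = 3"
    using nz by (simp add: w_def)
  have reach: "\<exists>n t. \<bar>t - x \<bullet> xs\<bar> < 1 \<and> \<bar>l ^ n * t - y \<bullet> xs\<bar> < 1" for x y
  proof -
    obtain n z where "functional_seminorm xs (z - x) < 1"
      and "functional_seminorm xs ((T ^^ n) z - y) < 1"
      using wt zero_less_one unfolding weakly_transitive_for_def by blast
    then show ?thesis
      by (auto simp: functional_seminorm_def inner_diff_left eigenfunctional_funpow[OF eigen])
  qed
  show False
  proof (cases "\<bar>l\<bar> \<le> 1")
    case True
    obtain n t where t: "\<bar>t\<bar> < 1" "\<bar>l ^ n * t - 3\<bar> < 1"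
      using reach[of 0 w] w by auto
    have "\<bar>l ^ n * t\<bar> \<le> \<bar>t\<bar>"
      using True by (simp add: abs_mult power_abs power_le_one mult_left_le_one_le)
    with t show False by linarith
  next
    case False
    obtain n t where t: "\<bar>t - 3\<bar> < 1" "\<bar>l ^ n * t\<bar> < 1"
      using reach[of w 0] w by auto
    have "1 \<le> \<bar>l\<bar> ^ n"
      using False by (simp add: one_le_power)
    then have "\<bar>t\<bar> \<le> \<bar>l ^ n * t\<bar>"
      using mult_right_mono[of 1 "\<bar>l\<bar> ^ n" "\<bar>t\<bar>"] by (simp add: abs_mult power_abs)
    with t show False by linarith
  qed
qed

lemma weakly_transitive_for_diagonal:
  fixes l1 l2 :: real and xs :: "real^2"
  assumes neq: "l1 \<noteq> l2" and nz: "xs $ 1 * xs $ 2 \<noteq> 0"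
  shows "weakly_transitive_for (\<lambda>x. vector [vector [l1, 0], vector [0, l2]] *v x) xs"
    (is "weakly_transitive_for ?T xs")
  unfolding weakly_transitive_for_def
proof (intro allI impI)
  fix x y :: "real^2" and \<epsilon> :: real
  assume "\<epsilon> > 0"
  define c d where "c = x \<bullet> xs" and "d = y \<bullet> xs"
  \<comment> \<open>Cramer's rule for \<open>u + v = c\<close>, \<open>l1 * u + l2 * v = d\<close>, where \<open>u\<close> and \<open>v\<close> are the two
    summands of \<open>z \<bullet> xs\<close>.\<close>
  define u v where "u = (d - l2 * c) / (l1 - l2)" and "v = (l1 * c - d) / (l1 - l2)"
  define z :: "real^2" where "z = vector [u / xs $ 1, v / xs $ 2]"
  have "z \<bullet> xs = u + v"
    using nz by (simp add: z_def inner_vec_def sum_2)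
  also have "\<dots> = c"
    using neq by (simp add: u_def v_def divide_simps) (simp add: algebra_simps)
  finally have "functional_seminorm xs (z - x) = 0"
    by (simp add: functional_seminorm_def inner_diff_left c_def)
  moreover have "l1 * u + l2 * v = d"
    using neq by (simp add: u_def v_def divide_simps) (simp add: algebra_simps)
  then have "?T z \<bullet> xs = d"
    using nz by (simp add: diagonal_inner z_def)
  then have "functional_seminorm xs ((?T ^^ 1) z - y) = 0"
    by (simp add: functional_seminorm_def inner_diff_left d_def)
  ultimately show "\<exists>n\<ge>1. \<exists>z. functional_seminorm xs (z - x) < \<epsilon>
      \<and> functional_seminorm xs ((?T ^^ n) z - y) < \<epsilon>"
    using \<open>\<epsilon> > 0\<close> by (metis order_refl)
qed

theorem theorem3p1:
  fixes l1 l2 :: real and A :: "real^2^2" and T :: "real^2 \<Rightarrow> real^2"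
  assumes "A = vector [vector [l1, 0], vector [0, l2]]"
    and "T = (\<lambda>x. A *v x)"
  shows "(l1 \<noteq> l2 \<longrightarrow> (\<forall>xs. xs $ 1 * xs $ 2 \<noteq> 0 \<longrightarrow> weakly_transitive_for T xs))
    \<and> (l1 = l2 \<longrightarrow> (\<forall>xs. xs \<noteq> 0 \<longrightarrow> \<not> weakly_transitive_for T xs))
    \<and> \<not> strongly_transitive T"
proof (intro conjI impI allI)
  fix xs :: "real^2"
  assume "l1 \<noteq> l2" and "xs $ 1 * xs $ 2 \<noteq> 0"
  then show "weakly_transitive_for T xs"
    using weakly_transitive_for_diagonal assms by simp
next
  fix xs :: "real^2"
  assume "l1 = l2" and "xs \<noteq> 0"
  then have "T x \<bullet> xs = l1 * (x \<bullet> xs)" for x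
    unfolding assms diagonal_inner by (simp add: inner_vec_def sum_2 algebra_simps)
  then show "\<not> weakly_transitive_for T xs"
    using \<open>xs \<noteq> 0\<close> by (rule not_weakly_transitive_for_eigenfunctional)
next
  define e :: "real^2" where "e = axis 1 1"
  have "e \<noteq> 0"
    by (simp add: e_def axis_eq_0_iff)
  have "T x \<bullet> e = l1 * (x \<bullet> e)" for x
    unfolding assms diagonal_inner by (simp add: inner_vec_def sum_2 e_def axis_def)
  then have "\<not> weakly_transitive_for T e"
    using \<open>e \<noteq> 0\<close> by (rule not_weakly_transitive_for_eigenfunctional)
  with \<open>e \<noteq> 0\<close> show "\<not> strongly_transitive T"
    unfolding strongly_transitive_def by blast
qed

end
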